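(* Let $0<q<1$. As an identity of formal power series in the indeterminates $u,v$, \[ \sum_{m=0}^\infty\sum_{n=0}^\infty u^{m+1}v^{n+1}\,\zeta[m+2,\{1\}^n] = 1-\exp\bigg\{\sum_{k=2}^\infty\Big(u^k+v^k-\big(u+v+(1-q)uv\big)^k\Big)\frac1k\sum_{j=2}^k(q-1)^{k-j}\zeta[j]\bigg\}. \]
   Context: Fix $0<q<1$ and $[x]_q := (1-q^x)/(1-q)$. For positive integers $s_1,\dots,s_N$ with $s_1>1$, $\zeta[s_1,\dots,s_N] := \sum_{k_1>\cdots>k_N>0}\prod_{j=1}^N q^{(s_j-1)k_j}/[k_j]_q^{s_j}$ (sum over positive integers). $\{1\}^n$ denotes $n$ consecutive copies of $1$ in an argument list (empty if $n=0$). *)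

theory Defs
  imports "HOL-Analysis.Analysis" "HOL-Computational_Algebra.Formal_Power_Series"
begin

definition qint :: "real \<Rightarrow> nat \<Rightarrow> real" where
  "qint q x = (1 - q ^ x) / (1 - q)"

definition qmzv_index :: "nat \<Rightarrow> nat list set" where
  "qmzv_index N = {ks. length ks = N \<and> sorted_wrt (>) ks \<and> (\<forall>k\<in>set ks. k > 0)}"

definition qmzv :: "real \<Rightarrow> nat list \<Rightarrow> real" where
  "qmzv q s = (\<Sum>\<^sub>\<infinity> ks \<in> qmzv_index (length s).
      \<Prod>j<length s. q ^ ((s ! j - 1) * (ks ! j)) / (qint q (ks ! j)) ^ (s ! j))"

text \<open>Bivariate formal power series in u, v are modelled as real fps fps:
  the outer variable is u, the inner one is v; the coefficient of u^a v^b in F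
  is fps_nth (fps_nth F a) b.\<close>
type_synonym fps2 = "real fps fps"

definition fpsU :: fps2 where "fpsU = fps_X"
definition fpsV :: fps2 where "fpsV = fps_const fps_X"
definition fps2_const :: "real \<Rightarrow> fps2" where "fps2_const c = fps_const (fps_const c)"

text \<open>Formal (coefficientwise) sum of a family of bivariate series; meaningful
  when every coefficient receives contributions from only finitely many members.\<close>
definition fps2_sum :: "('i \<Rightarrow> fps2) \<Rightarrow> fps2" where
  "fps2_sum f = Abs_fps (\<lambda>a. Abs_fps (\<lambda>b. \<Sum>\<^sub>\<infinity> i. fps_nth (fps_nth (f i) a) b))"

text \<open>Formal exponential exp G = sum_k G^k / k! (for G with zero constant term).\<close>
definition fps2_exp :: "fps2 \<Rightarrow> fps2" where
  "fps2_exp G = fps2_sum (\<lambda>k::nat. fps2_const (1 / fact k) * G ^ k)"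

end

theory Submission
  imports Defs
begin

text \<open>
  Put \<open>t\<^sub>n = q^n / [n]\<close>, \<open>z = 1 - q\<close> and \<open>w = u + v + z u v\<close>. Since \<open>t\<^sub>n + z = 1 / [n]\<close>, the
  inner sum over \<open>j\<close> on the right telescopes to \<open>\<Sum>n. t\<^sub>n^k - t\<^sub>n (-z)^(k - 1)\<close>. The terms with
  \<open>(-z)^(k - 1)\<close> contribute nothing because \<open>1 + z w = (1 + z u) (1 + z v)\<close>, so the exponential is the
  limit of \<open>P\<^sub>N = \<Prod>n\<le>N. (1 - t\<^sub>n w) / ((1 - t\<^sub>n u) (1 - t\<^sub>n v))\<close>. This limit is taken
  coefficientwise: it satisfies the same linear differential equation in \<open>u\<close> as the exponential, and
  both are \<open>1\<close> at \<open>u = 0\<close>.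

  With \<open>A = 1 + z u\<close> and \<open>B = 1 + z v\<close>, \<open>P\<^sub>N\<close> is the right-hand side of the terminating
  q-Pfaff-Saalschuetz sum. As \<open>N\<close> tends to infinity, the sum itself tends to one minus the generating
  function of the values \<open>\<zeta>[m+2,{1}^n]\<close> by Tannery's theorem (this is the q-Gauss limit, taken
  coefficientwise).
\<close>

section \<open>A terminating q-Pfaff-Saalschuetz sum\<close>

text \<open>One step of the Wilf-Zeilberger certificate, with \<open>p = Q^(k+1)\<close>, \<open>Y = Q^(N-k)\<close>, \<open>X = Q^(N+1)\<close>.\<close>
lemma saalschutz_step:
  fixes A B p Y a b c d X M :: "'a::comm_ring_1"
  assumes "a * (1 - A * p) = 1" "b * (1 - p) = 1" "c * (1 - A * X) = 1" "d * (1 - B * Y) = 1"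
    and "X = p * Y"
  shows "M * (a * p * b * (1 - X)) - M * ((1 - A * B * X) * (1 - X) * c * a * p * b * (1 - Y) * d)
       = X * c * M - X * c * M * b * (B - p) * (1 - Y) * d"
proof -
  have "a * p * b * (1 - X) = a * p * b * (1 - X) * (c * (1 - A * X)) * (d * (1 - B * Y))"
    using assms by simp
  moreover have "X * c = X * c * (a * (1 - A * p)) * (b * (1 - p)) * (d * (1 - B * Y))"
    using assms by simp
  moreover have "X * c * b * (B - p) * (1 - Y) * d = X * c * b * (B - p) * (1 - Y) * d * (a * (1 - A * p))"
    using assms by simp
  moreover have "a * p * b * (1 - X) * (c * (1 - A * X)) * (d * (1 - B * Y))
      - (1 - A * B * X) * (1 - X) * c * a * p * b * (1 - Y) * d
     = X * c * (a * (1 - A * p)) * (b * (1 - p)) * (d * (1 - B * Y))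
       - X * c * b * (B - p) * (1 - Y) * d * (a * (1 - A * p))"
    unfolding assms(5) by (simp add: algebra_simps)
  ultimately have "a * p * b * (1 - X) - (1 - A * B * X) * (1 - X) * c * a * p * b * (1 - Y) * d
     = X * c - X * c * b * (B - p) * (1 - Y) * d"
    by simp
  from arg_cong[OF this, of "\<lambda>x. M * x"] show ?thesis
    by (simp add: algebra_simps)
qed

text \<open>The terminating q-Pfaff-Saalschuetz sum with parameters \<open>A\<close>, \<open>1/B\<close>, \<open>Q^-N\<close> over \<open>A Q\<close>, \<open>Q^-N/B\<close>,
  with all powers of \<open>1/B\<close> and \<open>1/Q\<close> cleared. The inverses are passed explicitly, as the ring of
  bivariate series is not a field.\<close>
lemma q_saalschutz:
  fixes A B Q :: "'a::comm_ring_1" and iA iB iQ :: "nat \<Rightarrow> 'a"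
  assumes iA: "\<And>n. n > 0 \<Longrightarrow> iA n * (1 - A * Q ^ n) = 1"
    and iB: "\<And>n. n > 0 \<Longrightarrow> iB n * (1 - B * Q ^ n) = 1"
    and iQ: "\<And>n. n > 0 \<Longrightarrow> iQ n * (1 - Q ^ n) = 1"
  shows "1 + (\<Sum>k<N. (1 - A) * iA (Suc k) * Q ^ Suc k * (\<Prod>j\<le>k. (B - Q ^ j) * iQ (Suc j))
               * (\<Prod>j\<le>k. (1 - Q ^ (N - j)) * iB (N - j)))
       = (\<Prod>n=1..N. (1 - A * B * Q ^ n) * (1 - Q ^ n) * iA n * iB n)"
proof (induction N)
  case 0
  show ?case by simp
next
  case (Suc N)
  define C where "C k = (\<Prod>j<k. (B - Q ^ j) * iQ (Suc j))" for k
  define D where "D N k = (\<Prod>j<k. (1 - Q ^ (N - j)) * iB (N - j))" for N k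
  define h where "h N k = (1 - A) * iA (Suc k) * Q ^ Suc k * C (Suc k) * D N (Suc k)" for N k
  define X where "X = Q ^ Suc N"
  \<comment> \<open>\<open>\<rho>\<close> is the quotient of the right-hand sides for
    \<open>Suc N\<close> and \<open>N\<close>. Below, \<open>M k\<close> collects the factors shared
    by \<open>h (Suc N) k\<close> and \<open>\<rho> * h N k\<close>.\<close>
  define \<rho> where "\<rho> = (1 - A * B * X) * (1 - X) * iA (Suc N) * iB (Suc N)"
  define M where "M k = iB (Suc N) * (1 - A) * C k * (B - Q ^ k) * D N k" for k
  have C_Suc: "C (Suc k) = C k * ((B - Q ^ k) * iQ (Suc k))" for k
    by (simp add: C_def)
  have D_Suc: "D N (Suc k) = D N k * ((1 - Q ^ (N - k)) * iB (N - k))" for N k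
    by (simp add: D_def)
  have D_shift: "D (Suc N) (Suc k) = (1 - X) * iB (Suc N) * D N k" for k
    unfolding D_def X_def by (subst prod.lessThan_Suc_shift) simp
  have iA': "iA (Suc N) * (1 - A * X) = 1" and iB': "iB (Suc N) * (1 - B * X) = 1"
    unfolding X_def by (rule iA iB; simp)+
  \<comment> \<open>The correction term is the certificate: \<open>h (Suc N) k - \<rho> * h N k\<close> telescopes in \<open>k\<close>.\<close>
  have partial: "1 + (\<Sum>k<K. h (Suc N) k) = \<rho> * (1 + (\<Sum>k<K. h N k)) - X * iA (Suc N) * M K"
    if "K \<le> N" for K
    using that
  proof (induction K)
    case 0
    have "1 = (iA (Suc N) * (1 - A * X)) * (iB (Suc N) * (1 - B * X))"
      by (simp add: iA' iB')
    also have "\<dots> = \<rho> - X * iA (Suc N) * M 0"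
      by (simp add: \<rho>_def M_def C_def D_def algebra_simps)
    finally show ?case by simp
  next
    case (Suc K)
    have X: "X = Q ^ Suc K * Q ^ (N - K)"
      using Suc.prems unfolding X_def by (simp flip: power_add power_Suc)
    have "h (Suc N) K = M K * (iA (Suc K) * Q ^ Suc K * iQ (Suc K) * (1 - X))"
      unfolding h_def M_def C_Suc D_shift by (simp only: ac_simps)
    moreover have "\<rho> * h N K = M K * ((1 - A * B * X) * (1 - X) * iA (Suc N) * iA (Suc K) * Q ^ Suc K
        * iQ (Suc K) * (1 - Q ^ (N - K)) * iB (N - K))"
      unfolding h_def M_def C_Suc D_Suc \<rho>_def by (simp only: ac_simps)
    moreover have "X * iA (Suc N) * M (Suc K) = X * iA (Suc N) * M K * iQ (Suc K) * (B - Q ^ Suc K)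
        * (1 - Q ^ (N - K)) * iB (N - K)"
      unfolding M_def C_Suc D_Suc by (simp only: ac_simps)
    ultimately have "h (Suc N) K - \<rho> * h N K = X * iA (Suc N) * M K - X * iA (Suc N) * M (Suc K)"
      using saalschutz_step[of "iA (Suc K)" A "Q ^ Suc K" "iQ (Suc K)" "iA (Suc N)" X "iB (N - K)"
          B "Q ^ (N - K)" "M K", OF iA iQ iA' iB X] Suc.prems
      by simp
    hence e: "h (Suc N) K = \<rho> * h N K + (X * iA (Suc N) * M K - X * iA (Suc N) * M (Suc K))"
      by (simp add: algebra_simps)
    have "1 + (\<Sum>k<Suc K. h (Suc N) k) = (1 + (\<Sum>k<K. h (Suc N) k)) + h (Suc N) K"
      by simp
    also have "1 + (\<Sum>k<K. h (Suc N) k) = \<rho> * (1 + (\<Sum>k<K. h N k)) - X * iA (Suc N) * M K"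
      using Suc by (simp only: Suc_leD)
    also have "\<dots> + h (Suc N) K = \<rho> * (1 + (\<Sum>k<Suc K. h N k)) - X * iA (Suc N) * M (Suc K)"
      unfolding e by (simp add: algebra_simps)
    finally show ?case .
  qed
  \<comment> \<open>The sum for \<open>Suc N\<close> has the additional term \<open>k = N\<close>.
    It cancels exactly the certificate left over in \<open>partial\<close> at \<open>K = N\<close>,
    because \<open>iQ (Suc N)\<close> inverts \<open>1 - X\<close>.\<close>
  have "h (Suc N) N = X * iA (Suc N) * M N * (iQ (Suc N) * (1 - Q ^ Suc N))"
    unfolding h_def M_def C_Suc D_shift X_def by (simp only: ac_simps)
  hence last: "h (Suc N) N = X * iA (Suc N) * M N"
    by (subst (asm) iQ) simp_all
  have "1 + (\<Sum>k<Suc N. h (Suc N) k) = \<rho> * (1 + (\<Sum>k<N. h N k))"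
    using partial[of N] last by (simp add: algebra_simps)
  also have "1 + (\<Sum>k<N. h N k) = (\<Prod>n=1..N. (1 - A * B * Q ^ n) * (1 - Q ^ n) * iA n * iB n)"
    using Suc.IH unfolding h_def C_def D_def by (simp only: lessThan_Suc_atMost)
  also have "\<rho> * \<dots> = (\<Prod>n=1..Suc N. (1 - A * B * Q ^ n) * (1 - Q ^ n) * iA n * iB n)"
    by (simp add: \<rho>_def X_def mult_ac)
  finally show ?case
    unfolding h_def C_def D_def by (simp only: lessThan_Suc_atMost)
qed

section \<open>Bivariate formal power series\<close>

abbreviation coeff2 :: "fps2 \<Rightarrow> nat \<Rightarrow> nat \<Rightarrow> real" where
  "coeff2 F a b \<equiv> fps_nth (fps_nth F a) b"

lemma fps2_eqI: "(\<And>a b. coeff2 F a b = coeff2 G a b) \<Longrightarrow> F = G"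
  by (simp add: fps_eq_iff)

lemma coeff2_mult:
  "coeff2 (F * G) a b = (\<Sum>i=0..a. \<Sum>j=0..b. coeff2 F i j * coeff2 G (a - i) (b - j))"
  by (simp add: fps_mult_nth fps_sum_nth)

lemma coeff2_sum: "coeff2 (\<Sum>i\<in>I. F i) a b = (\<Sum>i\<in>I. coeff2 (F i) a b)"
  by (simp add: fps_sum_nth)

lemma coeff2_const_mult [simp]: "coeff2 (fps2_const c * F) a b = c * coeff2 F a b"
  by (simp add: fps2_const_def)

lemma coeff2_mult_const [simp]: "coeff2 (F * fps2_const c) a b = coeff2 F a b * c"
  by (simp add: fps2_const_def)

lemma fps2_const_mult: "fps2_const (c * d) = fps2_const c * fps2_const d"
  and fps2_const_diff: "fps2_const (c - d) = fps2_const c - fps2_const d"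
  and fps2_const_minus: "fps2_const (- c) = - fps2_const c"
  and fps2_const_1 [simp]: "fps2_const 1 = 1"
  and fps2_const_0 [simp]: "fps2_const 0 = 0"
  by (simp_all add: fps2_const_def flip: fps_const_neg)

lemma fps2_const_power: "fps2_const (c ^ n) = fps2_const c ^ n"
  by (induction n) (simp_all add: fps2_const_mult)

lemma of_nat_fps2: "of_nat n = fps2_const (real n)"
  by (simp add: fps2_const_def fps_of_nat flip: fps_of_nat)

lemma coeff2_deriv: "coeff2 (fps_deriv F) a b = real (Suc a) * coeff2 F (Suc a) b"
  by (simp add: fps_of_nat [symmetric] del: of_nat_Suc)

lemma fps_deriv_const2 [simp]: "fps_deriv (fps2_const c) = 0"
  and fps_deriv_U [simp]: "fps_deriv fpsU = 1"
  and fps_deriv_V [simp]: "fps_deriv fpsV = 0"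
  by (simp_all add: fps2_const_def fpsU_def fpsV_def)

text \<open>Membership in the \<open>n\<close>-th power of the ideal generated by \<open>u\<close>
  and \<open>v\<close>. A family with \<open>ord2 (f k) k\<close> reaches each coefficient only
  finitely often.\<close>

definition ord2 :: "fps2 \<Rightarrow> nat \<Rightarrow> bool" where
  "ord2 F n \<longleftrightarrow> (\<forall>a b. a + b < n \<longrightarrow> coeff2 F a b = 0)"

lemma ord2_mult:
  assumes "ord2 F m" "ord2 G n"
  shows "ord2 (F * G) (m + n)"
  unfolding ord2_def
proof (intro allI impI)
  fix a b assume "a + b < m + n"
  have "coeff2 F i j * coeff2 G (a - i) (b - j) = 0" if "i \<le> a" "j \<le> b" for i j
  proof (cases "i + j < m")
    case False
    hence "(a - i) + (b - j) < n" using that \<open>a + b < m + n\<close> by linarith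
    thus ?thesis using assms(2) by (simp add: ord2_def)
  qed (use assms(1) in \<open>simp add: ord2_def\<close>)
  thus "coeff2 (F * G) a b = 0"
    unfolding coeff2_mult by (intro sum.neutral ballI) auto
qed

lemma ord2_0: "ord2 F 0"
  by (simp add: ord2_def)

lemma ord2_power:
  assumes "ord2 F 1"
  shows "ord2 (F ^ n) n"
proof (induction n)
  case (Suc n)
  thus ?case using ord2_mult[OF assms Suc] by simp
qed (simp add: ord2_0)

lemma ord2_mult_left: "ord2 G n \<Longrightarrow> ord2 (F * G) n"
  using ord2_mult[OF ord2_0[of F]] by simp

lemma ord2_add: "ord2 F n \<Longrightarrow> ord2 G n \<Longrightarrow> ord2 (F + G) n"
  and ord2_diff: "ord2 F n \<Longrightarrow> ord2 G n \<Longrightarrow> ord2 (F - G) n"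
  by (simp_all add: ord2_def)

lemma ord2_mult_const: "ord2 F n \<Longrightarrow> ord2 (F * fps2_const c) n"
  by (simp add: ord2_def)

lemma ord2_U: "ord2 fpsU 1" and ord2_V: "ord2 fpsV 1"
  by (simp_all add: ord2_def fpsU_def fpsV_def)

text \<open>The library's topology on formal power series is the \<open>X\<close>-adic one, in which the limits below do
  not exist; coefficientwise convergence in the reals is needed instead.\<close>
definition lim2 :: "(nat \<Rightarrow> fps2) \<Rightarrow> fps2 \<Rightarrow> bool" where
  "lim2 F L \<longleftrightarrow> (\<forall>a b. (\<lambda>N. coeff2 (F N) a b) \<longlonglongrightarrow> coeff2 L a b)"

lemma lim2_unique: "lim2 F L \<Longrightarrow> lim2 F M \<Longrightarrow> L = M"
  by (metis LIMSEQ_unique fps2_eqI lim2_def)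

lemma lim2_const: "lim2 (\<lambda>_. L) L"
  and lim2_diff: "lim2 F L \<Longrightarrow> lim2 G M \<Longrightarrow> lim2 (\<lambda>N. F N - G N) (L - M)"
  by (auto simp: lim2_def intro!: tendsto_intros)

lemma lim2_mult: "lim2 F L \<Longrightarrow> lim2 G M \<Longrightarrow> lim2 (\<lambda>N. F N * G N) (L * M)"
  unfolding lim2_def coeff2_mult by (auto intro!: tendsto_intros)

lemma lim2_deriv: "lim2 F L \<Longrightarrow> lim2 (\<lambda>N. fps_deriv (F N)) (fps_deriv L)"
  unfolding lim2_def coeff2_deriv by (auto intro!: tendsto_intros)

lemma lim2_Suc: "lim2 F L \<Longrightarrow> lim2 (\<lambda>N. F (Suc N)) L"
  unfolding lim2_def by (auto intro: LIMSEQ_Suc)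

text \<open>Members with \<open>k > a + b\<close> vanish at this coefficient, so the default value 0
  of a non-summable infinite sum never intervenes.\<close>

lemma coeff2_fps2_sum:
  assumes "\<And>k. ord2 (f k) k"
  shows "coeff2 (fps2_sum f) a b = (\<Sum>k\<le>a + b. coeff2 (f k) a b)"
proof -
  have "coeff2 (fps2_sum f) a b = (\<Sum>\<^sub>\<infinity>k. coeff2 (f k) a b)"
    by (simp add: fps2_sum_def)
  also have "\<dots> = (\<Sum>\<^sub>\<infinity>k\<in>{..a + b}. coeff2 (f k) a b)"
    using assms by (intro infsum_cong_neutral) (auto simp: ord2_def)
  finally show ?thesis by simp
qed

text \<open>Each coefficient of the partial sums is eventually constant. Identities between formal
  sums then follow from finite ones by \<open>lim2_unique\<close>.\<close>

lemma lim2_fps2_sum: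
  assumes "\<And>k. ord2 (f k) k"
  shows "lim2 (\<lambda>N. \<Sum>k<N. f k) (fps2_sum f)"
  unfolding lim2_def
proof (intro allI tendsto_eventually)
  fix a b
  have "coeff2 (\<Sum>k<N. f k) a b = coeff2 (fps2_sum f) a b" if "N > a + b" for N
  proof -
    have "(\<Sum>k<N. coeff2 (f k) a b) = (\<Sum>k\<le>a + b. coeff2 (f k) a b)"
      using assms that by (intro sum.mono_neutral_right) (auto simp: ord2_def)
    thus ?thesis by (simp only: coeff2_sum coeff2_fps2_sum[OF assms])
  qed
  thus "\<forall>\<^sub>F N in sequentially. coeff2 (\<Sum>k<N. f k) a b = coeff2 (fps2_sum f) a b"
    by (rule eventually_mono[OF eventually_gt_at_top])
qed

lemma lim2_ord2_zero:
  assumes "\<And>k. ord2 (f k) k"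
  shows "lim2 f 0"
  unfolding lim2_def
proof (intro allI tendsto_eventually)
  fix a b
  show "\<forall>\<^sub>F N in sequentially. coeff2 (f N) a b = coeff2 0 a b"
    by (rule eventually_mono[OF eventually_gt_at_top[of "a + b"]])
       (use assms in \<open>simp add: ord2_def\<close>)
qed

section \<open>Formal geometric series\<close>

definition geo2 :: "real \<Rightarrow> fps2 \<Rightarrow> fps2" where
  "geo2 s F = fps2_sum (\<lambda>k. fps2_const (s ^ k) * F ^ k)"

lemma ord2_geo2: "ord2 F 1 \<Longrightarrow> ord2 (fps2_const (s ^ k) * F ^ k) k"
  by (intro ord2_mult_left ord2_power)

lemma lim2_geo2: "ord2 F 1 \<Longrightarrow> lim2 (\<lambda>N. \<Sum>k<N. fps2_const (s ^ k) * F ^ k) (geo2 s F)"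
  unfolding geo2_def by (intro lim2_fps2_sum ord2_geo2)

text \<open>The partial sums telescope to \<open>1 - s^N F^N\<close>, whose last term has order at
  least \<open>N\<close> and vanishes in the limit. This supplies the explicit inverses that replace
  division.\<close>

lemma geo2_mult:
  assumes "ord2 F 1"
  shows "(1 - fps2_const s * F) * geo2 s F = 1"
proof (rule lim2_unique)
  show "lim2 (\<lambda>N. (1 - fps2_const s * F) * (\<Sum>k<N. fps2_const (s ^ k) * F ^ k))
          ((1 - fps2_const s * F) * geo2 s F)"
    by (intro lim2_mult lim2_const lim2_geo2 assms)
  have "(1 - fps2_const s * F) * (\<Sum>k<N. fps2_const (s ^ k) * F ^ k) = 1 - fps2_const (s ^ N) * F ^ N" for N
    using one_diff_power_eq[of "fps2_const s * F" N]
    by (simp add: power_mult_distrib fps2_const_power)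
  moreover have "lim2 (\<lambda>N. 1 - fps2_const (s ^ N) * F ^ N) (1 - 0)"
    by (intro lim2_diff lim2_const lim2_ord2_zero ord2_geo2 assms)
  ultimately show "lim2 (\<lambda>N. (1 - fps2_const s * F) * (\<Sum>k<N. fps2_const (s ^ k) * F ^ k)) 1"
    by simp
qed

lemma coeff2_U_power: "coeff2 (fpsU ^ k) a b = (if a = k \<and> b = 0 then 1 else 0)"
  and coeff2_V_power: "coeff2 (fpsV ^ k) a b = (if a = 0 \<and> b = k then 1 else 0)"
  by (simp_all add: fpsU_def fpsV_def fps_const_power)

lemma geo2_U: "geo2 s fpsU = Abs_fps (\<lambda>a. fps_const (s ^ a))"
proof (rule fps2_eqI)
  fix a b
  have "coeff2 (fps2_const (s ^ k) * fpsU ^ k) a b = (if k = a then if b = 0 then s ^ a else 0 else 0)" for k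
    by (simp add: coeff2_U_power)
  thus "coeff2 (geo2 s fpsU) a b = coeff2 (Abs_fps (\<lambda>a. fps_const (s ^ a))) a b"
    unfolding geo2_def by (subst coeff2_fps2_sum[OF ord2_geo2[OF ord2_U]]) simp
qed

lemma geo2_V: "geo2 s fpsV = fps_const (Abs_fps (\<lambda>b. s ^ b))"
proof (rule fps2_eqI)
  fix a b
  have "coeff2 (fps2_const (s ^ k) * fpsV ^ k) a b = (if k = b then if a = 0 then s ^ b else 0 else 0)" for k
    by (simp add: coeff2_V_power)
  thus "coeff2 (geo2 s fpsV) a b = coeff2 (fps_const (Abs_fps (\<lambda>b. s ^ b))) a b"
    unfolding geo2_def by (subst coeff2_fps2_sum[OF ord2_geo2[OF ord2_V]]) simp
qed

section \<open>A linear differential equation and the exponential\<close>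

lemma fps_linear_ode_unique:
  fixes F G H :: "'a::{idom, semiring_char_0} fps"
  assumes "fps_deriv F = H * F" "fps_deriv G = H * G" "fps_nth F 0 = fps_nth G 0"
  shows "F = G"
proof (rule fps_ext)
  fix n show "fps_nth F n = fps_nth G n"
  proof (induction n rule: less_induct)
    case (less n)
    show ?case
    proof (cases n)
      case (Suc m)
      \<comment> \<open>Coefficient \<open>m\<close> of \<open>H * F\<close> involves only
        coefficients up to \<open>m\<close> of \<open>F\<close>, where \<open>F\<close> and
        \<open>G\<close> agree by induction; characteristic zero then allows cancelling
        \<open>Suc m\<close>.\<close>
      have "fps_nth (fps_deriv F) m = fps_nth (fps_deriv G) m"
        unfolding assms fps_mult_nth using less Suc by (intro sum.cong) auto
      hence "of_nat (Suc m) * fps_nth F n = of_nat (Suc m) * fps_nth G n"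
        using Suc by simp
      thus ?thesis by (simp only: mult_cancel_left of_nat_eq_0_iff) simp
    qed (use assms in simp)
  qed
qed

text \<open>The derivative is the one in \<open>u\<close>. It turns term \<open>Suc k\<close> of the
  exponential into \<open>G'\<close> times term \<open>k\<close>, hence the shift between
  \<open>Suc N\<close> and \<open>N\<close> in the partial sums.\<close>

lemma fps2_exp_ode:
  assumes "ord2 G 1"
  shows "fps_deriv (fps2_exp G) = fps_deriv G * fps2_exp G"
proof (rule lim2_unique)
  let ?f = "\<lambda>k. fps2_const (1 / fact k) * G ^ k"
  have ord: "ord2 (?f k) k" for k
    by (intro ord2_mult_left ord2_power assms)
  have lim: "lim2 (\<lambda>N. \<Sum>k<N. ?f k) (fps2_exp G)"
    unfolding fps2_exp_def by (intro lim2_fps2_sum ord)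
  show "lim2 (\<lambda>N. fps_deriv (\<Sum>k<Suc N. ?f k)) (fps_deriv (fps2_exp G))"
    by (intro lim2_deriv lim2_Suc[OF lim])
  have "fps_deriv (?f (Suc k)) = fps_deriv G * ?f k" for k
  proof -
    have "fps2_const (1 / fact (Suc k)) * of_nat (Suc k) = fps2_const (1 / fact k)"
      unfolding of_nat_fps2 fps2_const_mult [symmetric] by (simp del: of_nat_Suc)
    thus ?thesis
      by (simp add: fps_deriv_power' mult_ac del: fact_Suc of_nat_Suc power_Suc)
  qed
  hence "fps_deriv (\<Sum>k<Suc N. ?f k) = fps_deriv G * (\<Sum>k<N. ?f k)" for N
    by (simp add: sum.lessThan_Suc_shift fps_deriv_sum sum_distrib_left del: sum.lessThan_Suc fact_Suc power_Suc)
  thus "lim2 (\<lambda>N. fps_deriv (\<Sum>k<Suc N. ?f k)) (fps_deriv G * fps2_exp G)"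
    using lim2_mult[OF lim2_const lim] by simp
qed

lemma fps2_exp_nth_0:
  assumes "ord2 G 1" "fps_nth G 0 = 0"
  shows "fps_nth (fps2_exp G) 0 = 1"
proof (rule fps_ext)
  fix b
  let ?f = "\<lambda>k. fps2_const (1 / fact k) * G ^ k"
  have ord: "ord2 (?f k) k" for k
    by (intro ord2_mult_left ord2_power assms)
  have "coeff2 (?f k) 0 b = (if k = 0 then fps_nth 1 b else 0)" for k
    using assms(2) by (simp add: fps_nth_power_0 power_0_left)
  thus "fps_nth (fps_nth (fps2_exp G) 0) b = fps_nth 1 b"
    unfolding fps2_exp_def by (subst coeff2_fps2_sum[OF ord]) simp
qed

section \<open>Multiple zeta values as single series\<close>

lemma Suc_qint_ge_1:
  assumes "0 < q" "q < 1"
  shows "qint q (Suc n) \<ge> 1"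
proof -
  have "q ^ Suc n \<le> q" using assms by (simp add: mult_left_le power_le_one)
  thus ?thesis using assms by (simp add: qint_def)
qed

text \<open>Generating polynomial of the elementary symmetric functions of
  \<open>1/[1], ..., 1/[k]\<close>. These are the truncated sums over the arguments 1, whose
  numerators \<open>q^0\<close> are trivial.\<close>

definition esum :: "real \<Rightarrow> nat \<Rightarrow> real fps" where
  "esum q k = (\<Prod>j=1..k. 1 + fps_const (1 / qint q j) * fps_X)"

definition below_index :: "nat \<Rightarrow> nat \<Rightarrow> nat list set" where
  "below_index n k = {ks \<in> qmzv_index n. \<forall>x\<in>set ks. x \<le> k}"

lemma below_index_0: "below_index 0 k = {[]}"
  by (auto simp: below_index_def qmzv_index_def)

lemma below_index_Suc_0: "below_index (Suc n) 0 = {}"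
  by (auto simp: below_index_def qmzv_index_def length_Suc_conv)

text \<open>A list either avoids \<open>Suc k\<close> or has it as head; the last linear factor of
  \<open>esum\<close> gives the same recursion.\<close>

lemma below_index_Suc_Suc:
  "below_index (Suc n) (Suc k) = below_index (Suc n) k \<union> (#) (Suc k) ` below_index n k"
proof (rule set_eqI)
  fix ks :: "nat list"
  show "ks \<in> below_index (Suc n) (Suc k) \<longleftrightarrow> ks \<in> below_index (Suc n) k \<union> (#) (Suc k) ` below_index n k"
  proof (cases ks)
    case (Cons x xs)
    thus ?thesis
      by (auto simp: below_index_def qmzv_index_def image_iff le_Suc_eq less_Suc_eq_le)
  qed (auto simp: below_index_def qmzv_index_def)
qed

lemma finite_below_index: "finite (below_index n k)"
proof (induction k arbitrary: n)
  case 0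
  show ?case by (cases n) (simp_all add: below_index_0 below_index_Suc_0)
next
  case (Suc k)
  thus ?case by (cases n) (simp_all add: below_index_0 below_index_Suc_Suc)
qed

lemma esum_nth: "fps_nth (esum q k) n = (\<Sum>ks\<in>below_index n k. \<Prod>x\<leftarrow>ks. 1 / qint q x)"
proof (induction k arbitrary: n)
  case 0
  show ?case by (cases n) (simp_all add: below_index_0 below_index_Suc_0 esum_def)
next
  case (Suc k)
  have step: "esum q (Suc k) = esum q k + fps_const (1 / qint q (Suc k)) * (fps_X * esum q k)"
    by (simp add: esum_def algebra_simps)
  show ?case
  proof (cases n)
    case 0
    thus ?thesis using Suc[of 0] by (simp add: step below_index_0)
  next
    case (Suc m)
    have disj: "below_index (Suc m) k \<inter> (#) (Suc k) ` below_index m k = {}"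
      by (auto simp: below_index_def)
    have "(\<Sum>ks\<in>(#) (Suc k) ` below_index m k. \<Prod>x\<leftarrow>ks. 1 / qint q x)
        = 1 / qint q (Suc k) * (\<Sum>ks\<in>below_index m k. \<Prod>x\<leftarrow>ks. 1 / qint q x)"
      by (subst sum.reindex) (auto simp: sum_distrib_left inj_on_def)
    thus ?thesis
      using Suc.IH[of m] Suc.IH[of "Suc m"]
      unfolding Suc below_index_Suc_Suc
      by (subst sum.union_disjoint[OF finite_below_index finite_imageI[OF finite_below_index] disj])
         (simp add: step)
  qed
qed

lemma qmzv_index_Suc:
  "qmzv_index (Suc n) = (\<lambda>(k, ks). Suc k # ks) ` (SIGMA k:UNIV. below_index n k)"
proof (rule set_eqI)
  fix ks :: "nat list"
  show "ks \<in> qmzv_index (Suc n) \<longleftrightarrow> ks \<in> (\<lambda>(k, ks). Suc k # ks) ` (SIGMA k:UNIV. below_index n k)"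
  proof (cases ks)
    case (Cons x xs)
    thus ?thesis
      by (cases x) (auto simp: below_index_def qmzv_index_def image_iff less_Suc_eq_le)
  qed (auto simp: qmzv_index_def)
qed

definition qt :: "real \<Rightarrow> nat \<Rightarrow> real" where
  "qt q n = q ^ n / qint q n"

text \<open>Contribution \<open>q^((m+1)(k+1)) / [k+1]^(m+2)\<close> of the leading argument
  \<open>m + 2\<close> at the index \<open>Suc k\<close>, shifted so that summation starts at
  0.\<close>

definition head_weight :: "real \<Rightarrow> nat \<Rightarrow> nat \<Rightarrow> real" where
  "head_weight q m k = qt q (Suc k) ^ Suc m / qint q (Suc k)"

text \<open>Splitting off the largest index gives an iterated sum; as all terms are nonnegative, its
  convergence justifies the rearrangement. Summability is supplied later by
  \<open>head_weight_sum_tendsto\<close>.\<close>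

lemma qmzv_eq_suminf:
  assumes q: "0 < q" "q < 1" and summable: "summable (\<lambda>k. head_weight q m k * fps_nth (esum q k) n)"
  shows "qmzv q ((m + 2) # replicate n 1) = (\<Sum>k. head_weight q m k * fps_nth (esum q k) n)"
proof -
  define s where "s = (m + 2) # replicate n 1"
  define f where "f ks = (\<Prod>j<length s. q ^ ((s ! j - 1) * (ks ! j)) / (qint q (ks ! j)) ^ (s ! j))" for ks
  define g where "g k ks = head_weight q m k * (\<Prod>x\<leftarrow>ks. 1 / qint q x)" for k ks
  have f: "f (Suc k # ks) = g k ks" if "ks \<in> below_index n k" for k ks
  proof -
    have len: "length ks = n" using that by (simp add: below_index_def qmzv_index_def)
    have "f (Suc k # ks) = q ^ ((m + 1) * Suc k) / qint q (Suc k) ^ (m + 2) *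
        (\<Prod>j<n. q ^ ((replicate n 1 ! j - 1) * (ks ! j)) / (qint q (ks ! j)) ^ (replicate n 1 ! j))"
      unfolding f_def s_def length_Cons length_replicate by (subst prod.lessThan_Suc_shift) simp
    also have "q ^ ((m + 1) * Suc k) = (q ^ Suc k) ^ Suc m"
      by (metis Suc_eq_plus1 mult.commute power_mult)
    also have "(q ^ Suc k) ^ Suc m / qint q (Suc k) ^ (m + 2) = head_weight q m k"
      by (simp add: head_weight_def qt_def power_divide mult_ac)
    also have "(\<Prod>j<n. q ^ ((replicate n 1 ! j - 1) * (ks ! j)) / (qint q (ks ! j)) ^ (replicate n 1 ! j))
        = (\<Prod>j<n. 1 / qint q (ks ! j))"
      by (intro prod.cong) auto
    also have "\<dots> = (\<Prod>x\<leftarrow>ks. 1 / qint q x)"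
      using len by (simp add: prod.list_conv_set_nth atLeast0LessThan)
    finally show ?thesis by (simp add: g_def)
  qed
  have nonneg: "g k ks \<ge> 0" for k ks
  proof -
    have "qint q x \<ge> 0" for x
      using q by (simp add: qint_def power_le_one)
    thus ?thesis unfolding g_def head_weight_def qt_def using q
      by (intro mult_nonneg_nonneg prod_list_nonneg divide_nonneg_nonneg zero_le_power) auto
  qed
  have inner: "((\<lambda>ks. g k ks) has_sum head_weight q m k * fps_nth (esum q k) n) (below_index n k)" for k
    unfolding esum_nth g_def sum_distrib_left by (intro has_sum_finite finite_below_index)
  have outer: "((\<lambda>k. head_weight q m k * fps_nth (esum q k) n) has_sum
      (\<Sum>k. head_weight q m k * fps_nth (esum q k) n)) UNIV"
  proof (rule sums_nonneg_imp_has_sum)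
    show "head_weight q m k * fps_nth (esum q k) n \<ge> 0" for k
      using has_sum_nonneg[OF inner nonneg] .
  qed (use summable in \<open>simp add: summable_sums\<close>)
  have "((\<lambda>(k, ks). g k ks) has_sum (\<Sum>k. head_weight q m k * fps_nth (esum q k) n))
          (SIGMA k:UNIV. below_index n k)"
  proof (rule has_sum_SigmaI)
    show "(\<lambda>(k, ks). g k ks) summable_on (SIGMA k:UNIV. below_index n k)"
      by (rule summable_on_SigmaI[OF _ has_sum_imp_summable[OF outer]])
         (use inner nonneg in auto)
  qed (use inner outer in auto)
  hence "infsum (\<lambda>(k, ks). g k ks) (SIGMA k:UNIV. below_index n k)
       = (\<Sum>k. head_weight q m k * fps_nth (esum q k) n)"
    by (rule infsumI)
  moreover have "qmzv q s = infsum f (qmzv_index (Suc n))"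
  proof -
    have "length s = Suc n" by (simp add: s_def)
    thus ?thesis unfolding qmzv_def f_def by (simp only:)
  qed
  moreover have "\<dots> = infsum (\<lambda>(k, ks). g k ks) (SIGMA k:UNIV. below_index n k)"
    unfolding qmzv_index_Suc
    by (subst infsum_reindex) (auto simp: inj_on_def f intro!: infsum_cong)
  ultimately show ?thesis by (simp add: s_def)
qed

section \<open>Power bounds for coefficients\<close>

text \<open>Domination by \<open>1 / (1 - T X)\<close>. Such bounds add up under multiplication, so
  a product is controlled by the sum of the parameters of its factors.\<close>

definition nonneg_bounded_by_powers :: "real fps \<Rightarrow> real \<Rightarrow> bool" where
  "nonneg_bounded_by_powers F T \<longleftrightarrow> (\<forall>i. 0 \<le> fps_nth F i \<and> fps_nth F i \<le> T ^ i)"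

lemma nonneg_bounded_by_powers_linear:
  assumes F: "nonneg_bounded_by_powers F T" and "0 \<le> T" "0 \<le> s"
  shows "nonneg_bounded_by_powers (F * (1 + fps_const s * fps_X)) (T + s)"
  unfolding nonneg_bounded_by_powers_def
proof
  fix i
  have eq: "F * (1 + fps_const s * fps_X) = F + fps_const s * (fps_X * F)"
    by (simp add: algebra_simps)
  have F: "0 \<le> fps_nth F i" "fps_nth F i \<le> T ^ i" for i
    using F by (auto simp: nonneg_bounded_by_powers_def)
  show "0 \<le> fps_nth (F * (1 + fps_const s * fps_X)) i \<and>
        fps_nth (F * (1 + fps_const s * fps_X)) i \<le> (T + s) ^ i"
  proof (cases i)
    case 0
    thus ?thesis using F[of 0] by (simp add: eq)
  next
    case (Suc j)
    have "fps_nth F (Suc j) + s * fps_nth F j \<le> T * T ^ j + s * T ^ j"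
      using F[of j] F[of "Suc j"] assms by (intro add_mono mult_left_mono) auto
    also have "\<dots> = (T + s) * T ^ j" by (simp add: algebra_simps)
    also have "\<dots> \<le> (T + s) * (T + s) ^ j"
      using assms by (intro mult_left_mono power_mono) auto
    finally show ?thesis using F[of j] F[of "Suc j"] assms Suc by (simp add: eq)
  qed
qed

lemma nonneg_bounded_by_powers_geometric:
  assumes F: "nonneg_bounded_by_powers F T" and "0 \<le> T" "0 \<le> s"
  shows "nonneg_bounded_by_powers (F * Abs_fps (\<lambda>i. s ^ i)) (T + s)"
  unfolding nonneg_bounded_by_powers_def
proof
  fix i
  let ?G = "F * Abs_fps (\<lambda>i. s ^ i)"
  have geo: "Abs_fps (\<lambda>i. s ^ i) = 1 + fps_const s * (fps_X * Abs_fps (\<lambda>i. s ^ i))"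
  proof (rule fps_ext)
    fix n show "fps_nth (Abs_fps (\<lambda>i. s ^ i)) n = fps_nth (1 + fps_const s * (fps_X * Abs_fps (\<lambda>i. s ^ i))) n"
      by (cases n) simp_all
  qed
  have eq: "?G = F + fps_const s * (fps_X * ?G)"
    by (subst geo) (simp add: algebra_simps)
  have rec: "fps_nth ?G (Suc j) = fps_nth F (Suc j) + s * fps_nth ?G j" for j
    by (subst eq) simp
  have F: "0 \<le> fps_nth F i" "fps_nth F i \<le> T ^ i" for i
    using F by (auto simp: nonneg_bounded_by_powers_def)
  show "0 \<le> fps_nth ?G i \<and> fps_nth ?G i \<le> (T + s) ^ i"
  proof (induction i)
    case 0
    show ?case using F[of 0] by simp
  next
    case (Suc j)
    have "fps_nth F (Suc j) + s * fps_nth ?G j \<le> T * T ^ j + s * (T + s) ^ j"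
      using Suc F[of "Suc j"] assms by (intro add_mono mult_left_mono) auto
    also have "\<dots> \<le> T * (T + s) ^ j + s * (T + s) ^ j"
      using assms by (intro add_mono mult_left_mono power_mono) auto
    also have "\<dots> = (T + s) ^ Suc j" by (simp add: algebra_simps)
    finally show ?case unfolding rec using Suc F[of "Suc j"] assms by simp
  qed
qed

text \<open>Every binomial coefficient in \<open>(S + T)^i\<close> is at least 1, so its expansion
  dominates the convolution of the two bounds.\<close>

lemma nonneg_bounded_by_powers_mult:
  assumes F: "nonneg_bounded_by_powers F S" and G: "nonneg_bounded_by_powers G T"
    and "0 \<le> S" "0 \<le> T"
  shows "nonneg_bounded_by_powers (F * G) (S + T)"
  unfolding nonneg_bounded_by_powers_def
proof (intro allI conjI)
  fix i
  show "fps_nth (F * G) i \<ge> 0"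
    using F G unfolding fps_mult_nth nonneg_bounded_by_powers_def by (intro sum_nonneg) auto
  have "fps_nth (F * G) i \<le> (\<Sum>j=0..i. S ^ j * T ^ (i - j))"
    using F G assms(3,4) unfolding fps_mult_nth nonneg_bounded_by_powers_def
    by (intro sum_mono mult_mono) auto
  also have "\<dots> \<le> (\<Sum>j=0..i. of_nat (i choose j) * S ^ j * T ^ (i - j))"
  proof (rule sum_mono)
    fix j assume "j \<in> {0..i}"
    hence "1 \<le> real (i choose j)" by (simp add: Suc_le_eq)
    hence "1 * (S ^ j * T ^ (i - j)) \<le> real (i choose j) * (S ^ j * T ^ (i - j))"
      using assms(3,4) by (intro mult_right_mono) auto
    thus "S ^ j * T ^ (i - j) \<le> of_nat (i choose j) * S ^ j * T ^ (i - j)" by simp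
  qed
  also have "\<dots> = (S + T) ^ i" by (simp add: binomial_ring atLeast0AtMost)
  finally show "fps_nth (F * G) i \<le> (S + T) ^ i" .
qed

lemma nonneg_bounded_by_powers_mono:
  assumes "nonneg_bounded_by_powers F S" "0 \<le> S" "S \<le> T"
  shows "nonneg_bounded_by_powers F T"
  using assms unfolding nonneg_bounded_by_powers_def by (meson order.trans power_mono)

lemma nonneg_bounded_by_powers_1: "0 \<le> T \<Longrightarrow> nonneg_bounded_by_powers 1 T"
  by (simp add: nonneg_bounded_by_powers_def)

lemma esum_bounded:
  assumes "0 < q" "q < 1"
  shows "nonneg_bounded_by_powers (esum q k) (real k)"
proof (induction k)
  case (Suc k)
  have "1 / qint q (Suc k) \<le> 1" "0 \<le> 1 / qint q (Suc k)"
    using Suc_qint_ge_1[OF assms, of k] by simp_all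
  thus ?case
    using nonneg_bounded_by_powers_linear[OF Suc, of "1 / qint q (Suc k)"]
    by (auto simp: esum_def intro: nonneg_bounded_by_powers_mono)
qed (simp add: esum_def nonneg_bounded_by_powers_1)

lemma geometric_prod_bounded:
  assumes "finite I" "\<And>i. i \<in> I \<Longrightarrow> s i \<ge> 0"
  shows "nonneg_bounded_by_powers (\<Prod>i\<in>I. Abs_fps (\<lambda>j. s i ^ j)) (\<Sum>i\<in>I. s i)"
  using assms
proof (induction I rule: finite_induct)
  case (insert x I)
  thus ?case
    using nonneg_bounded_by_powers_geometric[of "\<Prod>i\<in>I. Abs_fps (\<lambda>j. s i ^ j)" "\<Sum>i\<in>I. s i" "s x"]
    by (simp add: sum_nonneg mult.commute add.commute)
qed (simp add: nonneg_bounded_by_powers_1)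

text \<open>Consecutive terms have ratio \<open>q (1 + 1/(k + T))^b\<close>, which tends to
  \<open>q\<close>; the midpoint of \<open>q\<close> and 1 serves as the bound in the ratio
  test.\<close>

lemma summable_power_mult_poly:
  fixes q T :: real
  assumes "0 < q" "q < 1" "0 \<le> T"
  shows "summable (\<lambda>k. q ^ k * (real k + T) ^ b)"
proof -
  have "(\<lambda>k. q * (1 + inverse (T + real k)) ^ b) \<longlonglongrightarrow> q * (1 + 0) ^ b"
    by (intro tendsto_intros tendsto_inverse_0_at_top
          filterlim_tendsto_add_at_top[OF tendsto_const filterlim_real_sequentially])
  hence "\<forall>\<^sub>F k in sequentially. q * (1 + inverse (T + real k)) ^ b < (q + 1) / 2"
    using assms by (intro order_tendstoD) auto
  then obtain N where N: "\<And>k. k \<ge> N \<Longrightarrow> q * (1 + inverse (T + real k)) ^ b < (q + 1) / 2"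
    by (auto simp: eventually_at_top_linorder)
  show ?thesis
  proof (rule summable_ratio_test[of "(q + 1) / 2" "Suc N"])
    \<comment> \<open>Starting at \<open>Suc N\<close> makes \<open>k\<close> positive, so
      \<open>real k + T\<close> is invertible even if \<open>T = 0\<close>.\<close>
    fix k assume k: "Suc N \<le> k"
    have "real (Suc k) + T = (1 + inverse (T + real k)) * (real k + T)"
      using k assms by (simp add: field_simps)
    hence "q ^ Suc k * (real (Suc k) + T) ^ b
         = (q * (1 + inverse (T + real k)) ^ b) * (q ^ k * (real k + T) ^ b)"
      by (simp only: power_mult_distrib power_Suc mult_ac)
    also have "\<dots> \<le> (q + 1) / 2 * (q ^ k * (real k + T) ^ b)"
      using N[of k] k assms by (intro mult_right_mono) auto
    finally show "norm (q ^ Suc k * (real (Suc k) + T) ^ b)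
        \<le> (q + 1) / 2 * norm (q ^ k * (real k + T) ^ b)"
      using assms by simp
  qed (use assms in auto)
qed

section \<open>The Euler product\<close>

text \<open>The series \<open>w\<close>: the multiplicative formal group law with parameter
  \<open>z\<close>.\<close>

definition comp2 :: "real \<Rightarrow> fps2" where
  "comp2 z = fpsU + fpsV + fps2_const z * fpsU * fpsV"

lemma ord2_comp2: "ord2 (comp2 z) 1"
  unfolding comp2_def by (intro ord2_add ord2_mult_left ord2_U ord2_V)

lemma fps_deriv_comp2: "fps_deriv (comp2 z) = 1 + fps2_const z * fpsV"
  by (simp add: comp2_def algebra_simps)

lemma comp2_factor: "1 + fps2_const z * comp2 z = (1 + fps2_const z * fpsU) * (1 + fps2_const z * fpsV)"
  by (simp add: comp2_def algebra_simps)

text \<open>For \<open>x k = s^(k+1)\<close>, \<open>log_ratio z x\<close> is the \<open>u\<close>-derivative of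
  \<open>ln ((1 - s w) / ((1 - s u) (1 - s v)))\<close>.\<close>
definition log_ratio_coeff :: "real \<Rightarrow> nat \<Rightarrow> fps2" where
  "log_ratio_coeff z k = fpsU ^ k - (1 + fps2_const z * fpsV) * comp2 z ^ k"

definition log_ratio :: "real \<Rightarrow> (nat \<Rightarrow> real) \<Rightarrow> fps2" where
  "log_ratio z x = fps2_sum (\<lambda>k. log_ratio_coeff z k * fps2_const (x k))"

lemma ord2_log_ratio_coeff: "ord2 (log_ratio_coeff z k * fps2_const c) k"
  unfolding log_ratio_coeff_def
  by (intro ord2_mult_const ord2_diff ord2_mult_left ord2_power ord2_U ord2_comp2)

lemma coeff2_log_ratio:
  "coeff2 (log_ratio z x) a b = (\<Sum>k\<le>a + b. coeff2 (log_ratio_coeff z k) a b * x k)"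
  unfolding log_ratio_def by (subst coeff2_fps2_sum[OF ord2_log_ratio_coeff]) simp

lemma log_ratio_sum: "log_ratio z (\<lambda>k. \<Sum>i\<in>I. x i k) = (\<Sum>i\<in>I. log_ratio z (x i))"
proof (rule fps2_eqI)
  fix a b
  show "coeff2 (log_ratio z (\<lambda>k. \<Sum>i\<in>I. x i k)) a b = coeff2 (\<Sum>i\<in>I. log_ratio z (x i)) a b"
    unfolding coeff2_sum coeff2_log_ratio sum_distrib_left by (rule sum.swap)
qed

text \<open>Each coefficient depends on finitely many values of the sequence, so pointwise
  convergence suffices.\<close>

lemma lim2_log_ratio:
  assumes "\<And>k. (\<lambda>N. x N k) \<longlonglongrightarrow> y k"
  shows "lim2 (\<lambda>N. log_ratio z (x N)) (log_ratio z y)"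
  unfolding lim2_def coeff2_log_ratio using assms by (auto intro!: tendsto_intros)

text \<open>The powers of \<open>-z\<close> drop out because \<open>1 + z w\<close> factors as \<open>(1 + z u) (1 + z v)\<close>.\<close>
lemma log_ratio_geometric:
  "log_ratio z (\<lambda>k. s ^ Suc k - s * (- z) ^ k)
   = fps2_const s * (geo2 s fpsU - (1 + fps2_const z * fpsV) * geo2 s (comp2 z))"
proof -
  let ?D = "1 + fps2_const z * fpsV"
  let ?P = "\<lambda>c F N. \<Sum>k<N. fps2_const (c ^ k) * F ^ k"
  have lims: "lim2 (?P c fpsU) (geo2 c fpsU)" "lim2 (?P c (comp2 z)) (geo2 c (comp2 z))" for c
    by (intro lim2_geo2 ord2_U ord2_comp2)+
  have split: "log_ratio z (\<lambda>k. s ^ Suc k - s * (- z) ^ k)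
      = fps2_const s * ((geo2 s fpsU - geo2 (- z) fpsU)
          - ?D * (geo2 s (comp2 z) - geo2 (- z) (comp2 z)))"
  proof (rule lim2_unique)
    show "lim2 (\<lambda>N. \<Sum>k<N. log_ratio_coeff z k * fps2_const (s ^ Suc k - s * (- z) ^ k))
        (log_ratio z (\<lambda>k. s ^ Suc k - s * (- z) ^ k))"
      unfolding log_ratio_def by (intro lim2_fps2_sum ord2_log_ratio_coeff)
    have "(\<Sum>k<N. log_ratio_coeff z k * fps2_const (s ^ Suc k - s * (- z) ^ k))
        = fps2_const s * ((?P s fpsU N - ?P (- z) fpsU N)
            - ?D * (?P s (comp2 z) N - ?P (- z) (comp2 z) N))" for N
    proof -
      have 1: "log_ratio_coeff z k * fps2_const (s ^ Suc k - s * (- z) ^ k)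
          = fps2_const s * ((fps2_const (s ^ k) * fpsU ^ k - fps2_const ((- z) ^ k) * fpsU ^ k)
            - ?D * (fps2_const (s ^ k) * comp2 z ^ k - fps2_const ((- z) ^ k) * comp2 z ^ k))" for k
      proof -
        have ring: "(u - d * w) * (r * (x - y)) = r * ((x * u - y * u) - d * (x * w - y * w))"
          for u d w r x y :: fps2 by (simp add: algebra_simps)
        have "fps2_const (s ^ Suc k - s * (- z) ^ k)
            = fps2_const s * (fps2_const (s ^ k) - fps2_const ((- z) ^ k))"
          by (simp only: fps2_const_diff fps2_const_mult power_Suc right_diff_distrib)
        thus ?thesis unfolding log_ratio_coeff_def by (simp only: ring)
      qed
      have 2: "(\<Sum>k<N. r * ((a k - b k) - d * (e k - f k)))
          = r * (((\<Sum>k<N. a k) - (\<Sum>k<N. b k)) - d * ((\<Sum>k<N. e k) - (\<Sum>k<N. f k)))"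
        for r d :: fps2 and a b e f
        by (simp only: right_diff_distrib sum_subtractf sum_distrib_left)
      show ?thesis unfolding 1 by (rule 2)
    qed
    moreover have "lim2 (\<lambda>N. fps2_const s * ((?P s fpsU N - ?P (- z) fpsU N)
            - ?D * (?P s (comp2 z) N - ?P (- z) (comp2 z) N)))
        (fps2_const s * ((geo2 s fpsU - geo2 (- z) fpsU)
          - ?D * (geo2 s (comp2 z) - geo2 (- z) (comp2 z))))"
      by (intro lim2_mult lim2_diff lim2_const lims)
    ultimately show "lim2 (\<lambda>N. \<Sum>k<N. log_ratio_coeff z k * fps2_const (s ^ Suc k - s * (- z) ^ k))
        (fps2_const s * ((geo2 s fpsU - geo2 (- z) fpsU)
          - ?D * (geo2 s (comp2 z) - geo2 (- z) (comp2 z))))"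
      by (simp only:)
  qed
  \<comment> \<open>Both sides are inverse to \<open>1 + z u\<close>, the left one by
    \<open>comp2_factor\<close>.\<close>
  have cancel: "?D * geo2 (- z) (comp2 z) = geo2 (- z) fpsU"
  proof -
    have U: "(1 + fps2_const z * fpsU) * geo2 (- z) fpsU = 1"
      using geo2_mult[OF ord2_U, of "- z"] by (simp add: fps2_const_minus)
    have W: "(1 + fps2_const z * fpsU) * (?D * geo2 (- z) (comp2 z)) = 1"
      using geo2_mult[OF ord2_comp2, of "- z" z] by (simp add: fps2_const_minus comp2_factor mult.assoc)
    have "?D * geo2 (- z) (comp2 z)
        = ((1 + fps2_const z * fpsU) * geo2 (- z) fpsU) * (?D * geo2 (- z) (comp2 z))"
      unfolding U by (rule mult_1_left [symmetric])
    also have "\<dots> = geo2 (- z) fpsU * ((1 + fps2_const z * fpsU) * (?D * geo2 (- z) (comp2 z)))"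
      by (simp only: mult_ac)
    finally show ?thesis unfolding W by (simp only: mult_1_right)
  qed
  have "(a - b) - (c - b) = a - c" for a b c :: fps2
    by simp
  thus ?thesis unfolding split right_diff_distrib[of ?D] cancel by (simp only:)
qed

definition euler_factor :: "real \<Rightarrow> real \<Rightarrow> fps2" where
  "euler_factor z s = (1 - fps2_const s * comp2 z) * geo2 s fpsU * geo2 s fpsV"

text \<open>Differentiate \<open>(1 - s u) g = 1\<close> and multiply by \<open>g\<close>.\<close>

lemma fps_deriv_geo2_U: "fps_deriv (geo2 s fpsU) = fps2_const s * geo2 s fpsU * geo2 s fpsU"
proof -
  let ?g = "geo2 s fpsU" and ?u = "1 - fps2_const s * fpsU"
  have inv: "?u * ?g = 1" by (rule geo2_mult[OF ord2_U])
  have "fps_deriv (?u * ?g) = 0" by (simp only: inv) simp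
  hence u: "?u * fps_deriv ?g = fps2_const s * ?g"
    by (simp add: algebra_simps)
  have "fps_deriv ?g = (?u * ?g) * fps_deriv ?g"
    unfolding inv by (rule mult_1_left [symmetric])
  also have "\<dots> = ?g * (?u * fps_deriv ?g)"
    by (simp only: mult_ac)
  finally show ?thesis
    unfolding u by (simp only: mult_ac)
qed

text \<open>Logarithmic differentiation without logarithms. The terms \<open>s (-z)^k\<close> do not
  alter the value; they are carried along because they turn the power sums into combinations of zeta
  values.\<close>

lemma fps_deriv_euler_factor:
  "fps_deriv (euler_factor z s) = euler_factor z s * log_ratio z (\<lambda>k. s ^ Suc k - s * (- z) ^ k)"
proof -
  let ?g = "geo2 s fpsU" and ?h = "geo2 s fpsV" and ?D = "1 + fps2_const z * fpsV"
    and ?w = "1 - fps2_const s * comp2 z" and ?k = "geo2 s (comp2 z)"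
  have inv: "?w * ?k = 1" by (rule geo2_mult[OF ord2_comp2])
  have h: "fps_deriv ?h = 0" by (simp add: geo2_V)
  have "euler_factor z s * log_ratio z (\<lambda>k. s ^ Suc k - s * (- z) ^ k)
      = ?w * ?h * ?g * fps2_const s * ?g - fps2_const s * ?D * ?g * ?h * (?w * ?k)"
    unfolding log_ratio_geometric euler_factor_def by (simp add: algebra_simps)
  also have "\<dots> = fps_deriv (euler_factor z s)"
    unfolding inv by (simp add: euler_factor_def h fps_deriv_geo2_U fps_deriv_comp2 algebra_simps)
  finally show ?thesis by simp
qed

lemma fps_deriv_euler_prod:
  "fps_deriv (\<Prod>i\<in>I. euler_factor z (s i))
   = (\<Prod>i\<in>I. euler_factor z (s i)) * log_ratio z (\<lambda>k. \<Sum>i\<in>I. s i ^ Suc k - s i * (- z) ^ k)"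
  unfolding log_ratio_sum
  by (induction I rule: infinite_finite_induct)
     (simp_all add: fps_deriv_euler_factor algebra_simps)

section \<open>The Euler product as a terminating hypergeometric sum\<close>

lemma qint_pos: "0 < q \<Longrightarrow> q < 1 \<Longrightarrow> n > 0 \<Longrightarrow> qint q n > 0"
  by (simp add: qint_def power_less_one_iff)

text \<open>For \<open>k < N\<close>, the factors \<open>1 / (1 - t_n v)\<close> with
  \<open>n\<close> from \<open>N - k\<close> to \<open>N\<close>. They carry the whole dependence on
  \<open>N\<close> of the summand in \<open>euler_prod_eq\<close>.\<close>

definition tail_prod :: "real \<Rightarrow> nat \<Rightarrow> nat \<Rightarrow> real fps" where
  "tail_prod q N k = (\<Prod>j\<le>k. Abs_fps (\<lambda>i. qt q (N - j) ^ i))"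

lemma euler_prod_eq:
  assumes q: "0 < q" "q < 1"
  shows "1 - (\<Prod>n=1..N. euler_factor (1 - q) (qt q n))
    = (\<Sum>k<N. fps2_const (qt q (Suc k) / qint q (Suc k)) *
         (fpsU * (fpsV * (geo2 (qt q (Suc k)) fpsU * fps_const (esum q k * tail_prod q N k)))))"
proof -
  define z where "z = 1 - q"
  define d where "d n = 1 - q ^ n" for n
  define A where "A = 1 + fps2_const z * fpsU"
  define B where "B = 1 + fps2_const z * fpsV"
  define Q where "Q = fps2_const q"
  define iQ where "iQ n = fps2_const (1 / d n)" for n
  define iA where "iA n = iQ n * geo2 (qt q n) fpsU" for n
  define iB where "iB n = iQ n * geo2 (qt q n) fpsV" for n
  have z: "z \<noteq> 0" using q by (simp add: z_def)
  have d: "d n \<noteq> 0" if "n > 0" for n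
    using q that by (simp add: d_def power_less_one_iff less_imp_neq)
  have qint: "qint q n = d n / z" for n by (simp add: qint_def d_def z_def)
  have qt: "d n * qt q n = z * q ^ n" if "n > 0" for n
    using d[OF that] by (simp add: qt_def qint)
  have Qn: "1 - Q ^ n = fps2_const (d n)" for n
    by (simp add: Q_def d_def fps2_const_diff fps2_const_power)
  \<comment> \<open>Since \<open>z q^n = d n * t_n\<close>, each linear factor of the q-sum becomes
    \<open>d n\<close> times \<open>1 - t_n F\<close>; this is used for \<open>F = u\<close>,
    \<open>F = v\<close> and \<open>F = w\<close>.\<close>
  have fac: "1 - (1 + fps2_const z * F) * Q ^ n = fps2_const (d n) * (1 - fps2_const (qt q n) * F)"
    if "n > 0" for n F
  proof -
    have "1 - (1 + fps2_const z * F) * Q ^ n = (1 - Q ^ n) - fps2_const z * fps2_const (q ^ n) * F"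
      by (simp add: Q_def fps2_const_power algebra_simps)
    also have "\<dots> = fps2_const (d n) * (1 - fps2_const (qt q n) * F)"
      unfolding Qn fps2_const_mult [symmetric] qt[OF that, symmetric]
      by (simp add: fps2_const_mult algebra_simps)
    finally show ?thesis .
  qed
  have iQ: "iQ n * fps2_const (d n) = 1" if "n > 0" for n
    using d[OF that] by (simp add: iQ_def flip: fps2_const_mult)
  have iA: "iA n * (1 - A * Q ^ n) = 1" if "n > 0" for n
  proof -
    have "iA n * (1 - A * Q ^ n) = (iQ n * fps2_const (d n)) * ((1 - fps2_const (qt q n) * fpsU) * geo2 (qt q n) fpsU)"
      unfolding A_def fac[OF that] iA_def by (simp only: mult_ac)
    thus ?thesis unfolding geo2_mult[OF ord2_U] by (simp add: iQ that)
  qed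
  have iB: "iB n * (1 - B * Q ^ n) = 1" if "n > 0" for n
  proof -
    have "iB n * (1 - B * Q ^ n) = (iQ n * fps2_const (d n)) * ((1 - fps2_const (qt q n) * fpsV) * geo2 (qt q n) fpsV)"
      unfolding B_def fac[OF that] iB_def by (simp only: mult_ac)
    thus ?thesis unfolding geo2_mult[OF ord2_V] by (simp add: iQ that)
  qed
  have iQ': "iQ n * (1 - Q ^ n) = 1" if "n > 0" for n
    unfolding Qn using iQ that by simp
  have AB: "A * B = 1 + fps2_const z * comp2 z"
    by (simp add: A_def B_def comp2_factor)
  have factor: "(1 - A * B * Q ^ n) * (1 - Q ^ n) * iA n * iB n = euler_factor z (qt q n)" if "n > 0" for n
  proof -
    have "(1 - A * B * Q ^ n) * (1 - Q ^ n) * iA n * iB n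
        = (iQ n * fps2_const (d n)) * (iQ n * fps2_const (d n)) * euler_factor z (qt q n)"
      unfolding AB fac[OF that] Qn iA_def iB_def euler_factor_def by (simp only: mult_ac)
    thus ?thesis by (simp add: iQ that)
  qed
  \<comment> \<open>The factor \<open>j = 0\<close> is \<open>B - 1 = z v\<close>; for
    \<open>j > 0\<close>, \<open>B - q^j\<close> is \<open>d j * (1 + v / [j])\<close>. All
    \<open>d j\<close> cancel against the inverses, which run one step ahead and leave
    \<open>iQ (Suc k)\<close>.\<close>
  have esum: "(\<Prod>j\<le>k. (B - Q ^ j) * iQ (Suc j)) = fps2_const z * fpsV * iQ (Suc k) * fps_const (esum q k)" for k
  proof (induction k)
    case 0
    show ?case by (simp add: B_def esum_def)
  next
    case (Suc k)
    have "B - Q ^ Suc k = fps2_const (d (Suc k)) * (1 + fps2_const (1 / qint q (Suc k)) * fpsV)"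
    proof -
      have "d (Suc k) * (1 / qint q (Suc k)) = z"
        using d[of "Suc k"] by (simp add: qint)
      hence "fps2_const (d (Suc k)) * fps2_const (1 / qint q (Suc k)) = fps2_const z"
        by (metis fps2_const_mult)
      moreover have "B - Q ^ Suc k = (1 - Q ^ Suc k) + fps2_const z * fpsV"
        by (simp add: B_def)
      ultimately show ?thesis
        unfolding Qn by (simp add: distrib_left flip: mult.assoc)
    qed
    moreover have "fps_const (esum q (Suc k)) = fps_const (esum q k) * (1 + fps2_const (1 / qint q (Suc k)) * fpsV)"
      by (simp add: esum_def fps2_const_def fpsV_def flip: fps_const_mult fps_const_add)
    ultimately have "(\<Prod>j\<le>Suc k. (B - Q ^ j) * iQ (Suc j))
        = (iQ (Suc k) * fps2_const (d (Suc k))) *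
          (fps2_const z * fpsV * iQ (Suc (Suc k)) * fps_const (esum q (Suc k)))"
      unfolding prod.atMost_Suc Suc by (simp only: mult_ac)
    thus ?case by (simp add: iQ)
  qed
  have tail: "(\<Prod>j\<le>k. (1 - Q ^ (N - j)) * iB (N - j)) = fps_const (tail_prod q N k)" if "k < N" for k
  proof -
    have "(\<Prod>j\<le>k. (1 - Q ^ (N - j)) * iB (N - j)) = (\<Prod>j\<le>k. geo2 (qt q (N - j)) fpsV)"
    proof (rule prod.cong)
      fix j assume "j \<in> {..k}"
      hence "iQ (N - j) * (1 - Q ^ (N - j)) = 1" using that by (intro iQ') auto
      moreover have "(1 - Q ^ (N - j)) * iB (N - j) = (iQ (N - j) * (1 - Q ^ (N - j))) * geo2 (qt q (N - j)) fpsV"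
        unfolding iB_def by (simp only: mult_ac)
      ultimately show "(1 - Q ^ (N - j)) * iB (N - j) = geo2 (qt q (N - j)) fpsV"
        by simp
    qed simp
    also have "\<dots> = fps_const (tail_prod q N k)"
      unfolding geo2_V tail_prod_def by (induction k) (simp_all flip: fps_const_mult)
    finally show ?thesis .
  qed
  \<comment> \<open>This is the source of the factor \<open>u\<close> and of the sign that cancels
    the minus before the sum.\<close>
  have minus_A: "1 - A = - (fps2_const z * fpsU)"
    by (simp add: A_def)
  have "1 - (\<Prod>n=1..N. euler_factor z (qt q n))
      = - (\<Sum>k<N. (1 - A) * iA (Suc k) * Q ^ Suc k * (\<Prod>j\<le>k. (B - Q ^ j) * iQ (Suc j))
               * (\<Prod>j\<le>k. (1 - Q ^ (N - j)) * iB (N - j)))"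
    using q_saalschutz[of iA A Q iB B iQ N, OF iA iB iQ'] factor
    by (simp add: algebra_simps)
  also have "\<dots> = (\<Sum>k<N. fps2_const (qt q (Suc k) / qint q (Suc k)) *
         (fpsU * (fpsV * (geo2 (qt q (Suc k)) fpsU * fps_const (esum q k * tail_prod q N k)))))"
    unfolding sum_negf [symmetric]
  proof (rule sum.cong)
    fix k assume "k \<in> {..<N}"
    hence tail': "(\<Prod>j\<le>k. (1 - Q ^ (N - j)) * iB (N - j)) = fps_const (tail_prod q N k)"
      by (intro tail) simp
    have "qt q (Suc k) / qint q (Suc k) = z * (1 / d (Suc k)) * q ^ Suc k * z * (1 / d (Suc k))"
      using d[of "Suc k"] z by (simp add: qint qt_def)
    hence c: "fps2_const (qt q (Suc k) / qint q (Suc k))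
        = fps2_const z * iQ (Suc k) * Q ^ Suc k * fps2_const z * iQ (Suc k)"
      by (simp only: iQ_def Q_def fps2_const_mult fps2_const_power)
    show "- ((1 - A) * iA (Suc k) * Q ^ Suc k * (\<Prod>j\<le>k. (B - Q ^ j) * iQ (Suc j))
               * (\<Prod>j\<le>k. (1 - Q ^ (N - j)) * iB (N - j)))
        = fps2_const (qt q (Suc k) / qint q (Suc k)) *
         (fpsU * (fpsV * (geo2 (qt q (Suc k)) fpsU * fps_const (esum q k * tail_prod q N k))))"
      unfolding tail' esum c minus_A iA_def fps_const_mult [symmetric]
      by (simp only: mult_minus_left mult_minus_right minus_minus mult_ac)
  qed simp
  finally show ?thesis by (simp only: z_def)
qed

section \<open>Passage to the limit\<close>

lemma qt_nonneg: "0 < q \<Longrightarrow> q < 1 \<Longrightarrow> 0 \<le> qt q n"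
  by (simp add: qt_def qint_def power_le_one)

lemma qt_le:
  assumes "0 < q" "q < 1" "n > 0"
  shows "qt q n \<le> q ^ n"
proof -
  have "1 \<le> qint q n" using Suc_qint_ge_1[OF assms(1,2), of "n - 1"] assms(3) by simp
  hence "q ^ n / qint q n \<le> q ^ n / 1"
    using assms by (intro divide_left_mono) auto
  thus ?thesis by (simp add: qt_def)
qed

lemma head_weight_bounds:
  assumes "0 < q" "q < 1"
  shows "0 \<le> head_weight q m k" "head_weight q m k \<le> q ^ k"
proof -
  have qint: "1 \<le> qint q (Suc k)" by (rule Suc_qint_ge_1[OF assms])
  have t0: "0 \<le> qt q (Suc k)" by (rule qt_nonneg[OF assms])
  show "0 \<le> head_weight q m k"
    unfolding head_weight_def using t0 qint by (intro divide_nonneg_nonneg) auto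
  have t1: "qt q (Suc k) \<le> q ^ Suc k" by (rule qt_le[OF assms]) simp
  have t2: "q ^ Suc k \<le> 1" using assms by (intro power_le_one) auto
  have "head_weight q m k \<le> qt q (Suc k) ^ Suc m / 1"
    unfolding head_weight_def using t0 qint by (intro divide_left_mono) auto
  also have "\<dots> \<le> qt q (Suc k)"
    using t0 t1 t2 by (simp add: mult_left_le power_le_one)
  also have "\<dots> \<le> q ^ k"
    using t1 assms by (simp add: mult_left_le_one_le order.trans)
  finally show "head_weight q m k \<le> q ^ k" .
qed

text \<open>The parameters \<open>t_n\<close> are summed against a geometric tail. The bound serves
  twice: it tends to 0 for fixed \<open>k\<close>, and it is at most \<open>1 / (1 - q)\<close>
  uniformly in \<open>k\<close> and \<open>N\<close>.\<close>

lemma tail_prod_bounded: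
  assumes q: "0 < q" "q < 1" and "k < N"
  shows "nonneg_bounded_by_powers (tail_prod q N k) (q ^ (N - k) / (1 - q))"
proof -
  have "(\<Sum>j\<le>k. qt q (N - j)) \<le> (\<Sum>j\<le>k. q ^ (N - j))"
    using assms by (intro sum_mono qt_le) auto
  also have "\<dots> \<le> q ^ (N - k) / (1 - q)"
    using \<open>k < N\<close>
  proof (induction k)
    case 0
    have "q ^ N * (1 - q) \<le> q ^ N" using q by (simp add: mult_left_le)
    thus ?case using q by (simp add: field_simps)
  next
    case (Suc k)
    have "(\<Sum>j\<le>Suc k. q ^ (N - j)) \<le> q ^ (N - k) / (1 - q) + q ^ (N - Suc k)"
      using Suc by simp
    also have "q ^ (N - k) = q * q ^ (N - Suc k)"
      using Suc.prems by (simp add: Suc_diff_Suc flip: power_Suc)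
    also have "q * q ^ (N - Suc k) / (1 - q) + q ^ (N - Suc k) = q ^ (N - Suc k) / (1 - q)"
      using q by (simp add: field_simps)
    finally show ?case .
  qed
  finally show ?thesis
    unfolding tail_prod_def
    by (intro nonneg_bounded_by_powers_mono[OF geometric_prod_bounded] sum_nonneg qt_nonneg q) auto
qed

lemma tail_prod_nth_0: "fps_nth (tail_prod q N k) 0 = 1"
  unfolding tail_prod_def by (induction k) simp_all

lemma tail_prod_tendsto:
  assumes q: "0 < q" "q < 1"
  shows "(\<lambda>N. fps_nth (tail_prod q N k) i) \<longlonglongrightarrow> fps_nth 1 i"
proof (cases "i = 0")
  case False
  have "(\<lambda>N. q ^ N) \<longlonglongrightarrow> 0" using q by (intro LIMSEQ_realpow_zero) auto
  hence "(\<lambda>N. q ^ (N - k)) \<longlonglongrightarrow> 0"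
    by (rule filterlim_compose) (rule filterlim_minus_const_nat_at_top)
  hence "(\<lambda>N. (q ^ (N - k) / (1 - q)) ^ i) \<longlonglongrightarrow> (0 / (1 - q)) ^ i"
    using q by (intro tendsto_intros) auto
  hence lim: "(\<lambda>N. (q ^ (N - k) / (1 - q)) ^ i) \<longlonglongrightarrow> 0"
    using False by (simp add: power_0_left)
  have "\<forall>\<^sub>F N in sequentially. 0 \<le> fps_nth (tail_prod q N k) i \<and>
      fps_nth (tail_prod q N k) i \<le> (q ^ (N - k) / (1 - q)) ^ i"
    by (rule eventually_mono[OF eventually_gt_at_top[of k]])
       (use tail_prod_bounded[OF q, of k] in \<open>simp add: nonneg_bounded_by_powers_def\<close>)
  hence "(\<lambda>N. fps_nth (tail_prod q N k) i) \<longlonglongrightarrow> 0"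
    by (intro tendsto_sandwich[OF _ _ tendsto_const lim]) (auto elim: eventually_mono)
  thus ?thesis using False by simp
qed (simp add: tail_prod_nth_0)

lemma head_weight_sum_tendsto:
  assumes q: "0 < q" "q < 1"
  shows "summable (\<lambda>k. head_weight q m k * fps_nth (esum q k) n)"
    and "(\<lambda>N. \<Sum>k<N. head_weight q m k * fps_nth (esum q k * tail_prod q N k) n)
          \<longlonglongrightarrow> (\<Sum>k. head_weight q m k * fps_nth (esum q k) n)"
proof -
  \<comment> \<open>Extension by zero for \<open>k >= N\<close> turns the finite sums into series
    over a fixed index set, as Tannery's theorem requires.\<close>
  define a where "a k N = (if k < N then head_weight q m k * fps_nth (esum q k * tail_prod q N k) n else 0)" for k N
  \<comment> \<open>The majorant combines \<open>q ^ k\<close> for the head weight with the additive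
    bounds \<open>k\<close> for \<open>esum\<close> and \<open>1 / (1 - q)\<close> for the tail
    product.\<close>
  define M where "M k = q ^ k * (real k + 1 / (1 - q)) ^ n" for k
  have "(\<lambda>N. fps_nth (esum q k * tail_prod q N k) n) \<longlonglongrightarrow> fps_nth (esum q k * 1) n" for k
    unfolding fps_mult_nth by (intro tendsto_sum tendsto_mult tendsto_const tail_prod_tendsto q)
  from tendsto_mult[OF tendsto_const this]
  have "(\<lambda>N. head_weight q m k * fps_nth (esum q k * tail_prod q N k) n)
      \<longlonglongrightarrow> head_weight q m k * fps_nth (esum q k * 1) n" for k .
  hence tail: "(\<lambda>N. head_weight q m k * fps_nth (esum q k * tail_prod q N k) n)
      \<longlonglongrightarrow> head_weight q m k * fps_nth (esum q k) n" for k
    by simp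
  have eq: "\<forall>\<^sub>F N in sequentially. a k N = head_weight q m k * fps_nth (esum q k * tail_prod q N k) n" for k
    by (rule eventually_mono[OF eventually_gt_at_top[of k]]) (simp add: a_def)
  have lim: "(\<lambda>N. a k N) \<longlonglongrightarrow> head_weight q m k * fps_nth (esum q k) n" for k
    by (rule tendsto_cong[OF eq, THEN iffD2, OF tail])
  have bound: "norm (a k N) \<le> M k" for k N
  proof (cases "k < N")
    case True
    have "q ^ (N - k) / (1 - q) \<le> 1 / (1 - q)"
      using q by (intro divide_right_mono power_le_one) auto
    hence "nonneg_bounded_by_powers (tail_prod q N k) (1 / (1 - q))"
      by (intro nonneg_bounded_by_powers_mono[OF tail_prod_bounded[OF q True]]) (use q in auto)
    from nonneg_bounded_by_powers_mult[OF esum_bounded[OF q] this]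
    have "0 \<le> fps_nth (esum q k * tail_prod q N k) n"
      "fps_nth (esum q k * tail_prod q N k) n \<le> (real k + 1 / (1 - q)) ^ n"
      using q by (auto simp: nonneg_bounded_by_powers_def)
    hence "head_weight q m k * fps_nth (esum q k * tail_prod q N k) n \<le> M k"
      unfolding M_def using head_weight_bounds[OF q, of m k] q by (intro mult_mono) auto
    moreover have "0 \<le> head_weight q m k * fps_nth (esum q k * tail_prod q N k) n"
      by (intro mult_nonneg_nonneg head_weight_bounds q) fact
    ultimately show ?thesis
      using True by (simp add: a_def)
  qed (use q in \<open>simp add: a_def M_def\<close>)
  have tannery: "(\<forall>\<^sub>F N in sequentially. summable (\<lambda>k. norm (a k N))) \<and>
      summable (\<lambda>k. norm (head_weight q m k * fps_nth (esum q k) n)) \<and>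
      ((\<lambda>N. \<Sum>k. a k N) \<longlonglongrightarrow> (\<Sum>k. head_weight q m k * fps_nth (esum q k) n))"
  proof (rule tannerys_theorem)
    show "\<forall>\<^sub>F (k, N) in at_top \<times>\<^sub>F sequentially. norm (a k N) \<le> M k"
      using bound by (intro always_eventually) auto
    show "summable M"
      unfolding M_def by (rule summable_power_mult_poly) (use q in auto)
  qed (rule lim, simp)
  have partial: "(\<Sum>k. a k N) = (\<Sum>k<N. head_weight q m k * fps_nth (esum q k * tail_prod q N k) n)" for N
  proof -
    have "(\<Sum>k. a k N) = (\<Sum>k<N. a k N)"
      by (intro suminf_finite) (auto simp: a_def)
    thus ?thesis by (simp add: a_def)
  qed
  show "(\<lambda>N. \<Sum>k<N. head_weight q m k * fps_nth (esum q k * tail_prod q N k) n)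
          \<longlonglongrightarrow> (\<Sum>k. head_weight q m k * fps_nth (esum q k) n)"
    using tannery[THEN conjunct2, THEN conjunct2] unfolding partial .
  show "summable (\<lambda>k. head_weight q m k * fps_nth (esum q k) n)"
    by (rule summable_norm_cancel) (rule tannery[THEN conjunct2, THEN conjunct1])
qed

section \<open>The exponent as a limit of power sums\<close>

lemma power_diff_telescope:
  fixes s c :: "'a::comm_ring_1"
  shows "s ^ Suc k - s * c ^ k = (\<Sum>j=2..Suc k. c ^ (Suc k - j) * (s ^ (j - 1) * (s - c)))"
proof (induction k)
  case (Suc k)
  have "(\<Sum>j=2..Suc (Suc k). c ^ (Suc (Suc k) - j) * (s ^ (j - 1) * (s - c)))
      = (\<Sum>j=2..Suc k. c ^ (Suc (Suc k) - j) * (s ^ (j - 1) * (s - c))) + s ^ Suc k * (s - c)"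
    by simp
  also have "(\<Sum>j=2..Suc k. c ^ (Suc (Suc k) - j) * (s ^ (j - 1) * (s - c)))
      = c * (\<Sum>j=2..Suc k. c ^ (Suc k - j) * (s ^ (j - 1) * (s - c)))"
    unfolding sum_distrib_left by (intro sum.cong) (simp_all add: Suc_diff_le mult_ac)
  also have "\<dots> = c * (s ^ Suc k - s * c ^ k)"
    by (simp only: Suc.IH)
  finally show ?case by (simp add: algebra_simps)
qed simp

lemma qt_power_sum_tendsto:
  assumes q: "0 < q" "q < 1"
  shows "(\<lambda>N. \<Sum>n=1..N. qt q n ^ Suc k - qt q n * (- (1 - q)) ^ k)
      \<longlonglongrightarrow> (\<Sum>j=2..Suc k. (q - 1) ^ (Suc k - j) * qmzv q [j])"
proof -
  \<comment> \<open>A single argument \<open>[j]\<close> is the case without ones, where only the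
    constant coefficient 1 of \<open>esum\<close> enters.\<close>
  have zeta: "(\<lambda>N. \<Sum>n<N. head_weight q (j - 2) n) \<longlonglongrightarrow> qmzv q [j]" if "j \<ge> 2" for j
  proof -
    have one: "fps_nth (esum q n) 0 = 1" for n
      by (simp add: esum_nth below_index_0)
    have "summable (\<lambda>n. head_weight q (j - 2) n)"
      using head_weight_sum_tendsto(1)[OF q, of "j - 2" 0] by (simp add: one)
    moreover have "qmzv q [j] = (\<Sum>n. head_weight q (j - 2) n)"
      using qmzv_eq_suminf[OF q head_weight_sum_tendsto(1)[OF q], of "j - 2" 0] that
      by (simp add: one del: One_nat_def add_2_eq_Suc')
    ultimately show ?thesis by (simp add: summable_LIMSEQ)
  qed
  have "qt q n ^ Suc k - qt q n * (- (1 - q)) ^ k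
      = (\<Sum>j=2..Suc k. (q - 1) ^ (Suc k - j) * head_weight q (j - 2) (n - 1))" if "n > 0" for n
  proof -
    \<comment> \<open>This is the factor \<open>s - c\<close> of \<open>power_diff_telescope\<close>
      for \<open>s = t_n\<close> and \<open>c = q - 1\<close>; its value \<open>1/[n]\<close> makes
      every summand a head weight.\<close>
    have "qt q n - (q - 1) = 1 / qint q n"
    proof -
      have "qint q n * (1 - q) = 1 - q ^ n" using q by (simp add: qint_def)
      thus ?thesis using qint_pos[OF q that] by (simp add: qt_def field_simps)
    qed
    moreover have "head_weight q (j - 2) (n - 1) = qt q n ^ (j - 1) * (1 / qint q n)" if "j \<ge> 2" for j
    proof -
      from that obtain i where "j = i + 2" by (metis add.commute le_Suc_ex)
      thus ?thesis using \<open>n > 0\<close> by (simp add: head_weight_def)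
    qed
    ultimately show ?thesis
      using power_diff_telescope[of "qt q n" k "q - 1"] by simp
  qed
  hence "(\<Sum>n=1..N. qt q n ^ Suc k - qt q n * (- (1 - q)) ^ k)
      = (\<Sum>n=1..N. \<Sum>j=2..Suc k. (q - 1) ^ (Suc k - j) * head_weight q (j - 2) (n - 1))" for N
    by (intro sum.cong) auto
  also have "\<dots> N = (\<Sum>n<N. \<Sum>j=2..Suc k. (q - 1) ^ (Suc k - j) * head_weight q (j - 2) n)" for N
    by (rule sum.reindex_bij_witness[of _ Suc "\<lambda>n. n - 1"]) auto
  also have "\<dots> N = (\<Sum>j=2..Suc k. (q - 1) ^ (Suc k - j) * (\<Sum>n<N. head_weight q (j - 2) n))" for N
    unfolding sum_distrib_left by (rule sum.swap)
  finally have eq: "(\<Sum>n=1..N. qt q n ^ Suc k - qt q n * (- (1 - q)) ^ k)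
      = (\<Sum>j=2..Suc k. (q - 1) ^ (Suc k - j) * (\<Sum>n<N. head_weight q (j - 2) n))" for N .
  show ?thesis
    unfolding eq by (intro tendsto_sum tendsto_mult tendsto_const zeta) simp
qed

text \<open>The index is a pair, so \<open>coeff2_fps2_sum\<close> does not apply; at most one pair
  contributes to a given coefficient.\<close>

lemma coeff2_double_sum:
  "coeff2 (fps2_sum (\<lambda>(m, n). fps2_const (c m n) * fpsU ^ (m + 1) * fpsV ^ (n + 1))) a b
   = (if a = 0 \<or> b = 0 then 0 else c (a - 1) (b - 1))"
proof -
  have coeff: "coeff2 (fps2_const x * fpsU ^ i * fpsV ^ j) a b = (if a = i \<and> b = j then x else 0)" for x i j
    unfolding mult.assoc coeff2_const_mult by (simp add: fpsU_def fpsV_def fps_const_power)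
  have "coeff2 (fps2_sum (\<lambda>(m, n). fps2_const (c m n) * fpsU ^ (m + 1) * fpsV ^ (n + 1))) a b
      = (\<Sum>\<^sub>\<infinity>(m, n). if a = m + 1 \<and> b = n + 1 then c m n else 0)"
    unfolding fps2_sum_def by (auto simp: coeff case_prod_unfold simp del: One_nat_def power_Suc intro!: infsum_cong)
  also have "\<dots> = (\<Sum>\<^sub>\<infinity>(m, n)\<in>(if a = 0 \<or> b = 0 then {} else {(a - 1, b - 1)}). c m n)"
    by (intro infsum_cong_neutral) (auto split: if_splits)
  also have "\<dots> = (if a = 0 \<or> b = 0 then 0 else c (a - 1) (b - 1))"
    by simp
  finally show ?thesis .
qed

text \<open>Termwise, \<open>(u^k + v^k - w^k) / k\<close> has the \<open>u\<close>-derivative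
  \<open>u^(k-1) - (1 + z v) w^(k-1)\<close>. At \<open>u = 0\<close> the exponent vanishes because
  \<open>w\<close> reduces to \<open>v\<close>.\<close>

lemma
  fixes x :: "nat \<Rightarrow> real" and z :: real
  assumes "x 1 = 0"
  defines "G \<equiv> fps2_sum (\<lambda>k. if k < 2 then 0 else
      (fpsU ^ k + fpsV ^ k - comp2 z ^ k) * fps2_const ((1 / real k) * x k))"
  shows fps_deriv_exponent: "fps_deriv G = log_ratio z (\<lambda>k. x (Suc k))"
    and exponent_nth_0: "fps_nth G 0 = 0"
proof -
  define f where "f k = (if k < 2 then 0 else
      (fpsU ^ k + fpsV ^ k - comp2 z ^ k) * fps2_const ((1 / real k) * x k))" for k
  have G: "G = fps2_sum f" by (simp only: G_def f_def[abs_def])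
  have ord: "ord2 (f k) k" for k
  proof (cases "k < 2")
    case True thus ?thesis by (simp add: f_def ord2_def)
  next
    case False thus ?thesis unfolding f_def
      by (auto intro!: ord2_mult_const ord2_diff ord2_add ord2_power ord2_U[simplified] ord2_V[simplified] ord2_comp2[simplified])
  qed
  show "fps_nth G 0 = 0"
  proof (rule fps_ext)
    fix b
    have "fps_nth (f k) 0 = 0" for k
      by (auto simp: f_def fps_nth_power_0 comp2_def fpsU_def fpsV_def)
    thus "fps_nth (fps_nth G 0) b = fps_nth 0 b"
      unfolding G coeff2_fps2_sum[OF ord] by simp
  qed
  have deriv: "fps_deriv (f (Suc k)) = log_ratio_coeff z k * fps2_const (x (Suc k))" for k
  proof (cases "k = 0")
    \<comment> \<open>The exponent starts at \<open>k = 2\<close>, whereas \<open>log_ratio\<close>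
      also contains \<open>x 1\<close>; the hypothesis \<open>x 1 = 0\<close> reconciles
      them.\<close>
    case True
    thus ?thesis using assms(1) by (simp add: f_def)
  next
    case False
    have "of_nat (Suc k) * fps2_const ((1 / real (Suc k)) * x (Suc k)) = fps2_const (x (Suc k))"
      unfolding of_nat_fps2 fps2_const_mult [symmetric] by (simp del: of_nat_Suc)
    moreover have "fps_deriv (f (Suc k)) = log_ratio_coeff z k *
        (of_nat (Suc k) * fps2_const ((1 / real (Suc k)) * x (Suc k)))"
      using False
      by (simp add: f_def fps_deriv_power' fps_deriv_comp2 log_ratio_coeff_def algebra_simps
          del: of_nat_Suc power_Suc)
    ultimately show ?thesis by simp
  qed
  show "fps_deriv G = log_ratio z (\<lambda>k. x (Suc k))"
  proof (rule lim2_unique)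
    show "lim2 (\<lambda>N. fps_deriv (\<Sum>k<Suc N. f k)) (fps_deriv G)"
      unfolding G by (intro lim2_deriv lim2_Suc[OF lim2_fps2_sum] ord)
    have "f 0 = 0" by (simp add: f_def)
    hence "fps_deriv (\<Sum>k<Suc N. f k) = (\<Sum>k<N. log_ratio_coeff z k * fps2_const (x (Suc k)))" for N
      by (simp add: sum.lessThan_Suc_shift fps_deriv_sum deriv del: sum.lessThan_Suc)
    thus "lim2 (\<lambda>N. fps_deriv (\<Sum>k<Suc N. f k)) (log_ratio z (\<lambda>k. x (Suc k)))"
      unfolding log_ratio_def by (simp only:) (intro lim2_fps2_sum ord2_log_ratio_coeff)
  qed
qed

section \<open>Identification of the two sides\<close>

lemma lim2_euler_prod:
  assumes q: "0 < q" "q < 1"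
  shows "lim2 (\<lambda>N. \<Prod>n=1..N. euler_factor (1 - q) (qt q n))
     (1 - fps2_sum (\<lambda>(m, n). fps2_const (qmzv q ((m + 2) # replicate n 1)) * fpsU ^ (m + 1) * fpsV ^ (n + 1)))"
    (is "lim2 ?P (1 - ?L)")
proof -
  have coeff: "coeff2 (fps2_const c * (fpsU * (fpsV * (geo2 s fpsU * fps_const F)))) a b
      = (if a = 0 \<or> b = 0 then 0 else c * s ^ (a - 1) * fps_nth F (b - 1))" for c s F a b
    by (cases a; cases b) (simp_all add: fpsU_def fpsV_def geo2_U[unfolded fpsU_def])
  have "lim2 (\<lambda>N. 1 - ?P N) ?L"
    unfolding lim2_def
  proof (intro allI)
    fix a b
    show "(\<lambda>N. coeff2 (1 - ?P N) a b) \<longlonglongrightarrow> coeff2 ?L a b"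
    proof (cases "a = 0 \<or> b = 0")
      case True
      thus ?thesis
        unfolding euler_prod_eq[OF q] coeff2_sum coeff coeff2_double_sum by auto
    next
      case False
      then obtain m n where [simp]: "a = Suc m" "b = Suc n" by (metis not0_implies_Suc)
      \<comment> \<open>The geometric series in \<open>u\<close> supplies \<open>t^m\<close>, which
        completes \<open>t / [k+1]\<close> to \<open>head_weight q m k\<close>, where
        \<open>t\<close> is \<open>qt q (Suc k)\<close>.\<close>
      have "coeff2 (1 - ?P N) a b
          = (\<Sum>k<N. head_weight q m k * fps_nth (esum q k * tail_prod q N k) n)" for N
        unfolding euler_prod_eq[OF q] coeff2_sum coeff by (simp add: head_weight_def)
      moreover have "coeff2 ?L a b = (\<Sum>k. head_weight q m k * fps_nth (esum q k) n)"
        unfolding coeff2_double_sum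
        using qmzv_eq_suminf[OF q head_weight_sum_tendsto(1)[OF q]] by simp
      ultimately show ?thesis using head_weight_sum_tendsto(2)[OF q] by simp
    qed
  qed
  from lim2_diff[OF lim2_const[of 1] this] show ?thesis by simp
qed

theorem theorem7p1:
  fixes q :: real
  assumes "0 < q" and "q < 1"
  shows "fps2_sum (\<lambda>(m::nat, n::nat).
            fps2_const (qmzv q ((m + 2) # replicate n 1)) * fpsU ^ (m + 1) * fpsV ^ (n + 1))
       = 1 - fps2_exp (fps2_sum (\<lambda>k::nat. if k < 2 then 0 else
            (fpsU ^ k + fpsV ^ k - (fpsU + fpsV + fps2_const (1 - q) * fpsU * fpsV) ^ k)
            * fps2_const ((1 / real k) * (\<Sum>j=2..k. (q - 1) ^ (k - j) * qmzv q [j]))))"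
proof -
  define z where "z = 1 - q"
  define x where "x k = (\<Sum>j=2..k. (q - 1) ^ (k - j) * qmzv q [j])" for k
  define G where "G = fps2_sum (\<lambda>k. if k < 2 then 0 else
      (fpsU ^ k + fpsV ^ k - comp2 z ^ k) * fps2_const ((1 / real k) * x k))"
  define L where "L = fps2_sum (\<lambda>(m::nat, n::nat).
            fps2_const (qmzv q ((m + 2) # replicate n 1)) * fpsU ^ (m + 1) * fpsV ^ (n + 1))"
  define P where "P N = (\<Prod>n=1..N. euler_factor z (qt q n))" for N
  define y where "y N k = (\<Sum>n=1..N. qt q n ^ Suc k - qt q n * (- z) ^ k)" for N k
  have x1: "x 1 = 0" by (simp add: x_def)
  have G0: "fps_nth G 0 = 0" and G': "fps_deriv G = log_ratio z (\<lambda>k. x (Suc k))"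
    unfolding G_def by (rule exponent_nth_0 fps_deriv_exponent, rule x1)+
  have ordG: "ord2 G 1"
    using G0 by (simp add: ord2_def)
  have limP: "lim2 P (1 - L)"
    unfolding P_def L_def z_def by (rule lim2_euler_prod[OF assms])
  have "lim2 (\<lambda>N. log_ratio z (y N)) (fps_deriv G)"
    unfolding G' y_def x_def z_def by (intro lim2_log_ratio qt_power_sum_tendsto assms)
  hence "lim2 (\<lambda>N. P N * log_ratio z (y N)) ((1 - L) * fps_deriv G)"
    by (intro lim2_mult limP)
  moreover have "fps_deriv (P N) = P N * log_ratio z (y N)" for N
    unfolding P_def y_def by (rule fps_deriv_euler_prod)
  \<comment> \<open>Differentiation and multiplication respect coefficientwise limits, so the
    differential equation of the finite products passes to \<open>1 - L\<close>.\<close>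
  ultimately have "fps_deriv (1 - L) = (1 - L) * fps_deriv G"
    using lim2_deriv[OF limP] by (auto intro: lim2_unique)
  hence "fps_deriv (1 - L) = fps_deriv G * (1 - L)"
    by (simp only: mult.commute)
  hence "1 - L = fps2_exp G"
  proof (rule fps_linear_ode_unique[OF _ fps2_exp_ode[OF ordG]])
    \<comment> \<open>Every term of \<open>L\<close> carries a positive power of \<open>u\<close>,
      so both solutions are 1 at \<open>u = 0\<close>.\<close>
    have "fps_nth L 0 = 0"
      unfolding L_def by (intro fps_ext) (simp only: coeff2_double_sum, simp)
    thus "fps_nth (1 - L) 0 = fps_nth (fps2_exp G) 0"
      by (simp add: fps2_exp_nth_0 ordG G0 del: One_nat_def)
  qed
  hence "L = 1 - fps2_exp G" by (simp add: algebra_simps)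
  thus ?thesis
    unfolding L_def G_def comp2_def z_def x_def .
qed

end
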